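(* Let $n\geq 8$ be an integer. Then $\Delta_D(A_n)^*$ is connected if and only if none of $n$, $n-1$, $n-2$ is a prime.
   Context: $A_n$ is the alternating group. The deep commuting graph $\Delta_D(G)$ has vertex set $G$, distinct vertices adjacent iff their preimages commute in a Schur cover $\tilde G$ of $G$ (a central extension $\{e\}\to M(G)\to\tilde G\to G\to\{e\}$ with kernel contained in $Z(\tilde G)\cap[\tilde G,\tilde G]$, of maximal order; $M(G)$ the Schur multiplier). A vertex is dominant if adjacent to every other vertex; the reduced graph $\Gamma^*$ is the subgraph induced by the non-dominant vertices. *)

theory Defs
  imports "HOL-Algebra.Algebra" "HOL-Computational_Algebra.Primes"
begin

definition group_center :: "('a, 'm) monoid_scheme \<Rightarrow> 'a set" where
  "group_center H = {z \<in> carrier H. \<forall>x \<in> carrier H. z \<otimes>\<^bsub>H\<^esub> x = x \<otimes>\<^bsub>H\<^esub> z}"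

definition stem_extension ::
  "('a, 'm) monoid_scheme \<Rightarrow> ('b, 'n) monoid_scheme \<Rightarrow> ('b \<Rightarrow> 'a) \<Rightarrow> bool" where
  "stem_extension G H \<pi> \<longleftrightarrow>
     group H \<and> \<pi> \<in> hom H G \<and> \<pi> ` carrier H = carrier G \<and>
     kernel H G \<pi> \<subseteq> group_center H \<inter> derived H (carrier H)"

text \<open>A Schur cover: a stem extension whose (finite) kernel has maximal order among all
  stem extensions.  Competing extensions are taken with carrier in nat; every countable
  group, in particular every finite one, is isomorphic to such a group.\<close>
definition schur_cover ::
  "('a, 'm) monoid_scheme \<Rightarrow> ('b, 'n) monoid_scheme \<Rightarrow> ('b \<Rightarrow> 'a) \<Rightarrow> bool" where
  "schur_cover G H \<pi> \<longleftrightarrow>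
     stem_extension G H \<pi> \<and> finite (kernel H G \<pi>) \<and>
     (\<forall>(K :: nat monoid) rho. stem_extension G K rho \<and> finite (kernel K G rho)
        \<longrightarrow> card (kernel K G rho) \<le> card (kernel H G \<pi>))"

text \<open>Adjacency in the deep commuting graph: distinct vertices whose preimages commute.
  (Since the kernel is central, this does not depend on the chosen preimages.)\<close>
definition deep_adj ::
  "('a, 'm) monoid_scheme \<Rightarrow> ('b, 'n) monoid_scheme \<Rightarrow> ('b \<Rightarrow> 'a) \<Rightarrow> 'a \<Rightarrow> 'a \<Rightarrow> bool" where
  "deep_adj G H \<pi> x y \<longleftrightarrow>
     x \<in> carrier G \<and> y \<in> carrier G \<and> x \<noteq> y \<and>
     (\<exists>x' \<in> carrier H. \<exists>y' \<in> carrier H. \<pi> x' = x \<and> \<pi> y' = y \<and>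
        x' \<otimes>\<^bsub>H\<^esub> y' = y' \<otimes>\<^bsub>H\<^esub> x')"

definition dominant :: "'v set \<Rightarrow> ('v \<Rightarrow> 'v \<Rightarrow> bool) \<Rightarrow> 'v \<Rightarrow> bool" where
  "dominant V E v \<longleftrightarrow> v \<in> V \<and> (\<forall>w \<in> V. w \<noteq> v \<longrightarrow> E v w)"

definition reduced_vertices :: "'v set \<Rightarrow> ('v \<Rightarrow> 'v \<Rightarrow> bool) \<Rightarrow> 'v set" where
  "reduced_vertices V E = {v \<in> V. \<not> dominant V E v}"

text \<open>Connectedness of the subgraph induced on W (empty graph counts as connected).\<close>
definition connected_induced :: "'v set \<Rightarrow> ('v \<Rightarrow> 'v \<Rightarrow> bool) \<Rightarrow> bool" where
  "connected_induced W E \<longleftrightarrow>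
     (\<forall>u \<in> W. \<forall>v \<in> W. (\<lambda>a b. a \<in> W \<and> b \<in> W \<and> E a b)\<^sup>*\<^sup>* u v)"

abbreviation nat_prime :: "nat \<Rightarrow> bool" where
  "nat_prime p \<equiv> Factorial_Ring.prime p"

end

theory Submission
  imports Defs
begin

text \<open>
  Only the centrality of the kernel matters. Commuting lifts project to commuting elements. If
  \<open>p \<in> {n, n - 1, n - 2}\<close> is prime, then every nontrivial power of a \<open>p\<close>-cycle generates the same
  subgroup, which is its own centralizer; so these powers are cut off from the rest of the graph.

  Conversely, for fixed \<open>u\<close> the commutator of lifts is a homomorphism from the centralizer of \<open>u\<close>
  to the kernel, so it vanishes on every even permutation moving only points of a set of at least
  five fixed points of \<open>u\<close>, and the square of any element commuting with an involution \<open>x\<close> is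
  adjacent to \<open>x\<close>. Hence an even permutation with three fixed points is adjacent to a 3-cycle, and
  any two 3-cycles are joined through a third one. An arbitrary element is first replaced by a
  power \<open>x\<close> of prime order \<open>p\<close>. If \<open>p = 2\<close> and \<open>x\<close> has at most two fixed points, then \<open>x\<close> is
  adjacent to the square of \<open>(a b c)(xa xb xc)\<close>; if \<open>p\<close> is odd and \<open>x\<close> is not a single cycle of
  length at least \<open>n - 2\<close>, then \<open>x\<close> is adjacent to each of its cycles.
\<close>

section \<open>Commuting lifts in central extensions\<close>

locale central_extension = group_hom H G \<pi> for H and G and \<pi> +
  assumes surj: "\<pi> ` carrier H = carrier G"
    and central: "kernel H G \<pi> \<subseteq> group_center H"
begin

definition lifts_commute where
  "lifts_commute x y \<longleftrightarrow> (\<exists>x' \<in> carrier H. \<exists>y' \<in> carrier H. \<pi> x' = x \<and> \<pi> y' = y \<and>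
     x' \<otimes>\<^bsub>H\<^esub> y' = y' \<otimes>\<^bsub>H\<^esub> x')"

lemma obtain_lift:
  assumes "x \<in> carrier G"
  obtains x' where "x' \<in> carrier H" "\<pi> x' = x"
  using assms unfolding surj[symmetric] by (elim imageE) simp

lemma kernel_closed: "z \<in> kernel H G \<pi> \<Longrightarrow> z \<in> carrier H"
  by (simp add: kernel_def)

lemma kernel_central:
  "z \<in> kernel H G \<pi> \<Longrightarrow> a \<in> carrier H \<Longrightarrow> z \<otimes>\<^bsub>H\<^esub> a = a \<otimes>\<^bsub>H\<^esub> z"
  by (drule subsetD[OF central]) (unfold group_center_def, blast)

lemma lifts_differ_by_kernel:
  assumes "a \<in> carrier H" "b \<in> carrier H" "\<pi> a = \<pi> b"
  obtains k where "k \<in> kernel H G \<pi>" "a = k \<otimes>\<^bsub>H\<^esub> b"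
proof
  show "a \<otimes>\<^bsub>H\<^esub> inv\<^bsub>H\<^esub> b \<in> kernel H G \<pi>"
    using assms by (simp add: kernel_def)
  show "a = a \<otimes>\<^bsub>H\<^esub> inv\<^bsub>H\<^esub> b \<otimes>\<^bsub>H\<^esub> b"
    using assms by (simp add: G.m_assoc)
qed

lemma kernel_left_commute:
  assumes "z \<in> kernel H G \<pi>" "a \<in> carrier H" "b \<in> carrier H"
  shows "a \<otimes>\<^bsub>H\<^esub> (z \<otimes>\<^bsub>H\<^esub> b) = z \<otimes>\<^bsub>H\<^esub> (a \<otimes>\<^bsub>H\<^esub> b)"
  using kernel_closed[OF assms(1)] kernel_central[OF assms(1,2)] assms(2,3) by (simp flip: G.m_assoc)

text \<open>Two lifts of one element differ by a kernel element, and central factors cancel from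
  both products. So one commuting pair of lifts makes every pair commute.\<close>

lemma lifts_commuteD:
  assumes "lifts_commute x y" "a \<in> carrier H" "b \<in> carrier H" "\<pi> a = x" "\<pi> b = y"
  shows "a \<otimes>\<^bsub>H\<^esub> b = b \<otimes>\<^bsub>H\<^esub> a"
proof -
  obtain x' y' where x': "x' \<in> carrier H" "\<pi> x' = x" and y': "y' \<in> carrier H" "\<pi> y' = y"
    and comm: "x' \<otimes>\<^bsub>H\<^esub> y' = y' \<otimes>\<^bsub>H\<^esub> x'"
    using assms(1) unfolding lifts_commute_def by blast
  obtain k where k: "k \<in> kernel H G \<pi>" "a = k \<otimes>\<^bsub>H\<^esub> x'"
    using lifts_differ_by_kernel[OF assms(2) x'(1)] x'(2) assms(4) by blast
  obtain l where l: "l \<in> kernel H G \<pi>" "b = l \<otimes>\<^bsub>H\<^esub> y'"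
    using lifts_differ_by_kernel[OF assms(3) y'(1)] y'(2) assms(5) by blast
  have kH: "k \<in> carrier H" and lH: "l \<in> carrier H"
    using kernel_closed k l by blast+
  have "a \<otimes>\<^bsub>H\<^esub> b = k \<otimes>\<^bsub>H\<^esub> (l \<otimes>\<^bsub>H\<^esub> (x' \<otimes>\<^bsub>H\<^esub> y'))"
    using kernel_left_commute[OF l(1) x'(1) y'(1)] kH lH x' y'
    by (simp add: k(2) l(2) G.m_assoc)
  moreover have "b \<otimes>\<^bsub>H\<^esub> a = l \<otimes>\<^bsub>H\<^esub> (k \<otimes>\<^bsub>H\<^esub> (y' \<otimes>\<^bsub>H\<^esub> x'))"
    using kernel_left_commute[OF k(1) y'(1) x'(1)] kH lH x' y'
    by (simp add: k(2) l(2) G.m_assoc)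
  ultimately show ?thesis
    using kernel_left_commute[OF l(1) kH, of "y' \<otimes>\<^bsub>H\<^esub> x'"] comm x' y' by simp
qed

lemma lifts_commute_imp_commute:
  assumes "lifts_commute x y" shows "x \<otimes>\<^bsub>G\<^esub> y = y \<otimes>\<^bsub>G\<^esub> x"
  using assms unfolding lifts_commute_def by (metis hom_mult)

lemma lifts_commute_sym: "lifts_commute x y \<Longrightarrow> lifts_commute y x"
  unfolding lifts_commute_def by metis

lemma lifts_commute_refl: "x \<in> carrier G \<Longrightarrow> lifts_commute x x"
  unfolding lifts_commute_def using obtain_lift by metis

lemma lifts_commute_one: "x \<in> carrier G \<Longrightarrow> lifts_commute x \<one>\<^bsub>G\<^esub>"
  unfolding lifts_commute_def
  by (rule obtain_lift, assumption, rule bexI, rule bexI[of _ "\<one>\<^bsub>H\<^esub>"]) auto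

lemma lifts_commute_mult:
  assumes "lifts_commute x y" "lifts_commute x z"
  shows "lifts_commute x (y \<otimes>\<^bsub>G\<^esub> z)"
proof -
  obtain x' y' where x': "x' \<in> carrier H" "\<pi> x' = x" and y': "y' \<in> carrier H" "\<pi> y' = y"
    and xy: "x' \<otimes>\<^bsub>H\<^esub> y' = y' \<otimes>\<^bsub>H\<^esub> x'"
    using assms(1) unfolding lifts_commute_def by blast
  obtain z' where z': "z' \<in> carrier H" "\<pi> z' = z"
    using assms(2) unfolding lifts_commute_def by blast
  have xz: "x' \<otimes>\<^bsub>H\<^esub> z' = z' \<otimes>\<^bsub>H\<^esub> x'"
    using lifts_commuteD[OF assms(2)] x' z' by blast
  have "x' \<otimes>\<^bsub>H\<^esub> (y' \<otimes>\<^bsub>H\<^esub> z') = (y' \<otimes>\<^bsub>H\<^esub> z') \<otimes>\<^bsub>H\<^esub> x'"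
    using x' y' z' xy xz by (metis G.m_assoc)
  thus ?thesis
    unfolding lifts_commute_def using x' y' z' by (metis G.m_closed hom_mult)
qed

lemma lifts_commute_pow:
  assumes "x \<in> carrier G" "lifts_commute x y"
  shows "lifts_commute x (y [^]\<^bsub>G\<^esub> (k::nat))"
  by (induction k) (auto intro: lifts_commute_one lifts_commute_mult assms)

section \<open>Commutators of lifts as kernel elements\<close>

lemma commute_up_to_kernel:
  assumes "x \<otimes>\<^bsub>G\<^esub> y = y \<otimes>\<^bsub>G\<^esub> x" "x' \<in> carrier H" "y' \<in> carrier H" "\<pi> x' = x" "\<pi> y' = y"
  obtains z where "z \<in> kernel H G \<pi>" "x' \<otimes>\<^bsub>H\<^esub> y' = z \<otimes>\<^bsub>H\<^esub> (y' \<otimes>\<^bsub>H\<^esub> x')"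
  using lifts_differ_by_kernel[of "x' \<otimes>\<^bsub>H\<^esub> y'" "y' \<otimes>\<^bsub>H\<^esub> x'"] assms by auto

text \<open>With \<open>u\<close> fixed, the commutator of lifts is multiplicative in the other
  argument because its values are central. Writing the commutator \<open>z\<close> as a factor in an
  equation avoids inverses.\<close>

lemma commute_mult_up_to_kernel:
  assumes "u \<in> carrier H" "a \<in> carrier H" "b \<in> carrier H"
    and z: "z \<in> kernel H G \<pi>" and w: "w \<in> kernel H G \<pi>"
    and a: "u \<otimes>\<^bsub>H\<^esub> a = z \<otimes>\<^bsub>H\<^esub> (a \<otimes>\<^bsub>H\<^esub> u)" and b: "u \<otimes>\<^bsub>H\<^esub> b = w \<otimes>\<^bsub>H\<^esub> (b \<otimes>\<^bsub>H\<^esub> u)"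
  shows "u \<otimes>\<^bsub>H\<^esub> (a \<otimes>\<^bsub>H\<^esub> b) = (z \<otimes>\<^bsub>H\<^esub> w) \<otimes>\<^bsub>H\<^esub> ((a \<otimes>\<^bsub>H\<^esub> b) \<otimes>\<^bsub>H\<^esub> u)"
proof -
  note [simp] = assms(1-3) kernel_closed[OF z] kernel_closed[OF w]
  have "u \<otimes>\<^bsub>H\<^esub> (a \<otimes>\<^bsub>H\<^esub> b) = z \<otimes>\<^bsub>H\<^esub> (a \<otimes>\<^bsub>H\<^esub> u) \<otimes>\<^bsub>H\<^esub> b"
    using a by (simp flip: G.m_assoc)
  also have "\<dots> = z \<otimes>\<^bsub>H\<^esub> (a \<otimes>\<^bsub>H\<^esub> (w \<otimes>\<^bsub>H\<^esub> (b \<otimes>\<^bsub>H\<^esub> u)))"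
    using b by (simp add: G.m_assoc)
  also have "\<dots> = (z \<otimes>\<^bsub>H\<^esub> w) \<otimes>\<^bsub>H\<^esub> ((a \<otimes>\<^bsub>H\<^esub> b) \<otimes>\<^bsub>H\<^esub> u)"
    by (simp add: kernel_left_commute[OF w, of a] G.m_assoc)
  finally show ?thesis .
qed

text \<open>Here \<open>r\<close> is the commutator of \<open>q\<close> and \<open>p\<close>. A
  homomorphism from the centralizer of \<open>u\<close> to the commutative kernel is trivial on
  commutators.\<close>

lemma lifts_commute_commutator:
  assumes G: "u \<in> carrier G" "p \<in> carrier G" "q \<in> carrier G" "r \<in> carrier G"
    and up: "u \<otimes>\<^bsub>G\<^esub> p = p \<otimes>\<^bsub>G\<^esub> u" and uq: "u \<otimes>\<^bsub>G\<^esub> q = q \<otimes>\<^bsub>G\<^esub> u"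
    and r: "q \<otimes>\<^bsub>G\<^esub> p = r \<otimes>\<^bsub>G\<^esub> (p \<otimes>\<^bsub>G\<^esub> q)"
  shows "lifts_commute u r"
proof -
  obtain u' where u': "u' \<in> carrier H" "\<pi> u' = u" using G obtain_lift by blast
  obtain p' where p': "p' \<in> carrier H" "\<pi> p' = p" using G obtain_lift by blast
  obtain q' where q': "q' \<in> carrier H" "\<pi> q' = q" using G obtain_lift by blast
  obtain z where z: "z \<in> kernel H G \<pi>" "u' \<otimes>\<^bsub>H\<^esub> p' = z \<otimes>\<^bsub>H\<^esub> (p' \<otimes>\<^bsub>H\<^esub> u')"
    using commute_up_to_kernel[OF up] u' p' by blast
  obtain w where w: "w \<in> kernel H G \<pi>" "u' \<otimes>\<^bsub>H\<^esub> q' = w \<otimes>\<^bsub>H\<^esub> (q' \<otimes>\<^bsub>H\<^esub> u')"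
    using commute_up_to_kernel[OF uq] u' q' by blast
  \<comment> \<open>\<open>g\<close> and \<open>h\<close> lift the two products of \<open>p\<close>
    and \<open>q\<close>. Both have the same commutator with \<open>u'\<close>, as the kernel is
    commutative, so their quotient \<open>r'\<close> commutes with \<open>u'\<close>.\<close>
  define g h where "g = q' \<otimes>\<^bsub>H\<^esub> p'" and "h = p' \<otimes>\<^bsub>H\<^esub> q'"
  define r' where "r' = g \<otimes>\<^bsub>H\<^esub> inv\<^bsub>H\<^esub> h"
  note [simp] = u' p' q' kernel_closed[OF z(1)] kernel_closed[OF w(1)]
  have gh [simp]: "g \<in> carrier H" "h \<in> carrier H" "r' \<in> carrier H"
    by (simp_all add: g_def h_def r'_def)
  have zw: "w \<otimes>\<^bsub>H\<^esub> z \<in> kernel H G \<pi>"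
    using z(1) w(1) subgroup_kernel by (simp add: subgroup.m_closed)
  have ug: "u' \<otimes>\<^bsub>H\<^esub> g = (w \<otimes>\<^bsub>H\<^esub> z) \<otimes>\<^bsub>H\<^esub> (g \<otimes>\<^bsub>H\<^esub> u')"
    unfolding g_def by (rule commute_mult_up_to_kernel) (use z w in auto)
  have uh: "u' \<otimes>\<^bsub>H\<^esub> h = (w \<otimes>\<^bsub>H\<^esub> z) \<otimes>\<^bsub>H\<^esub> (h \<otimes>\<^bsub>H\<^esub> u')"
    unfolding h_def kernel_central[OF w(1) kernel_closed[OF z(1)]]
    by (rule commute_mult_up_to_kernel) (use z w in auto)
  have rh: "r' \<otimes>\<^bsub>H\<^esub> h = g" by (simp add: r'_def G.m_assoc)
  have "(u' \<otimes>\<^bsub>H\<^esub> r') \<otimes>\<^bsub>H\<^esub> h = u' \<otimes>\<^bsub>H\<^esub> g"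
    using rh by (simp add: G.m_assoc)
  also have "\<dots> = (w \<otimes>\<^bsub>H\<^esub> z) \<otimes>\<^bsub>H\<^esub> (r' \<otimes>\<^bsub>H\<^esub> (h \<otimes>\<^bsub>H\<^esub> u'))"
    unfolding ug unfolding rh[symmetric] by (simp add: G.m_assoc)
  also have "\<dots> = r' \<otimes>\<^bsub>H\<^esub> (u' \<otimes>\<^bsub>H\<^esub> h)"
    unfolding uh by (rule kernel_left_commute[OF zw, symmetric]) simp_all
  also have "\<dots> = (r' \<otimes>\<^bsub>H\<^esub> u') \<otimes>\<^bsub>H\<^esub> h"
    by (simp add: G.m_assoc)
  finally have "u' \<otimes>\<^bsub>H\<^esub> r' = r' \<otimes>\<^bsub>H\<^esub> u'" by simp
  moreover have "\<pi> r' = r"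
  proof -
    have "\<pi> r' \<otimes>\<^bsub>G\<^esub> \<pi> h = \<pi> g" by (simp flip: rh)
    hence "\<pi> r' \<otimes>\<^bsub>G\<^esub> (p \<otimes>\<^bsub>G\<^esub> q) = r \<otimes>\<^bsub>G\<^esub> (p \<otimes>\<^bsub>G\<^esub> q)"
      using r by (simp add: g_def h_def)
    thus ?thesis using G by simp
  qed
  ultimately show ?thesis unfolding lifts_commute_def using u' gh by metis
qed

text \<open>The square of a lift \<open>a\<close> of \<open>x\<close> is central, while moving
  \<open>a\<close> past \<open>b\<close> twice costs \<open>z\<close> twice, so \<open>z\<close>
  squares to the identity. That square is also the commutator of \<open>a\<close> with the square of
  \<open>b\<close>.\<close>

lemma lifts_commute_square:
  assumes G: "x \<in> carrier G" "w \<in> carrier G" "x \<otimes>\<^bsub>G\<^esub> x = \<one>\<^bsub>G\<^esub>"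
    and comm: "x \<otimes>\<^bsub>G\<^esub> w = w \<otimes>\<^bsub>G\<^esub> x"
  shows "lifts_commute x (w \<otimes>\<^bsub>G\<^esub> w)"
proof -
  obtain a where a: "a \<in> carrier H" "\<pi> a = x" using G obtain_lift by blast
  obtain b where b: "b \<in> carrier H" "\<pi> b = w" using G obtain_lift by blast
  obtain z where z: "z \<in> kernel H G \<pi>" "a \<otimes>\<^bsub>H\<^esub> b = z \<otimes>\<^bsub>H\<^esub> (b \<otimes>\<^bsub>H\<^esub> a)"
    using commute_up_to_kernel[OF comm] a b by blast
  note [simp] = a b kernel_closed[OF z(1)]
  have aa: "a \<otimes>\<^bsub>H\<^esub> a \<in> kernel H G \<pi>" using G(3) by (simp add: kernel_def)
  have "(a \<otimes>\<^bsub>H\<^esub> a) \<otimes>\<^bsub>H\<^esub> b = a \<otimes>\<^bsub>H\<^esub> (z \<otimes>\<^bsub>H\<^esub> (b \<otimes>\<^bsub>H\<^esub> a))"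
    using z(2) by (simp add: G.m_assoc)
  also have "\<dots> = z \<otimes>\<^bsub>H\<^esub> ((a \<otimes>\<^bsub>H\<^esub> b) \<otimes>\<^bsub>H\<^esub> a)"
    using kernel_left_commute[OF z(1), of a "b \<otimes>\<^bsub>H\<^esub> a"] by (simp add: G.m_assoc)
  also have "\<dots> = (z \<otimes>\<^bsub>H\<^esub> z) \<otimes>\<^bsub>H\<^esub> (b \<otimes>\<^bsub>H\<^esub> (a \<otimes>\<^bsub>H\<^esub> a))"
    unfolding z(2) by (simp add: G.m_assoc)
  also have "b \<otimes>\<^bsub>H\<^esub> (a \<otimes>\<^bsub>H\<^esub> a) = (a \<otimes>\<^bsub>H\<^esub> a) \<otimes>\<^bsub>H\<^esub> b"
    using kernel_central[OF aa b(1)] by simp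
  finally have "z \<otimes>\<^bsub>H\<^esub> z = \<one>\<^bsub>H\<^esub>" by simp
  hence "a \<otimes>\<^bsub>H\<^esub> (b \<otimes>\<^bsub>H\<^esub> b) = (b \<otimes>\<^bsub>H\<^esub> b) \<otimes>\<^bsub>H\<^esub> a"
    using commute_mult_up_to_kernel[of a b b z z] z by simp
  thus ?thesis
    unfolding lifts_commute_def using a b by (metis G.m_closed hom_mult)
qed

end

section \<open>Permutations\<close>

lemma even_permutes_induct_transpositions [consumes 3, case_names id swap]:
  assumes "p permutes S" "finite S" "evenperm p"
    and base: "P id"
    and step: "\<And>a b c d q. a \<in> S \<Longrightarrow> b \<in> S \<Longrightarrow> c \<in> S \<Longrightarrow> d \<in> S \<Longrightarrow> a \<noteq> b \<Longrightarrow> c \<noteq> d \<Longrightarrow> P q \<Longrightarrow>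
      P (transpose a b \<circ> (transpose c d \<circ> q))"
  shows "P p"
proof -
  \<comment> \<open>\<open>permutes_induct\<close> adds one transposition at a time, so parity
    alternates. The claim for odd \<open>p\<close> speaks of \<open>p\<close> after one more
    transposition, which completes a pair.\<close>
  have "(evenperm p \<longrightarrow> P p) \<and>
    (\<not> evenperm p \<longrightarrow> (\<forall>a\<in>S. \<forall>b\<in>S. a \<noteq> b \<longrightarrow> P (transpose a b \<circ> p)))"
    using assms(1,2)
  proof (induction p rule: permutes_induct)
    case id
    show ?case using base by (simp add: id_def)
  next
    case (swap a b p)
    have "permutation p"
      using swap assms(2) by (auto simp: permutation_permutes)
    hence "evenperm (transpose a b \<circ> p) \<longleftrightarrow> \<not> evenperm p"
      using swap(3) by (simp add: evenperm_comp permutation_swap_id evenperm_swap)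
    hence "(evenperm (transpose a b \<circ> p) \<longrightarrow> P (transpose a b \<circ> p)) \<and>
      (\<not> evenperm (transpose a b \<circ> p) \<longrightarrow>
        (\<forall>c\<in>S. \<forall>d\<in>S. c \<noteq> d \<longrightarrow> P (transpose c d \<circ> (transpose a b \<circ> p))))"
      using swap step by blast
    thus ?case by (simp add: o_def)
  qed
  thus ?thesis using assms(3) by blast
qed

text \<open>For distinct points this is the cycle \<open>a -> b -> c -> a\<close>. For
  \<open>a = c\<close> it collapses to the identity, which the induction below exploits.\<close>

abbreviation three_cycle :: "'a \<Rightarrow> 'a \<Rightarrow> 'a \<Rightarrow> 'a \<Rightarrow> 'a" where
  "three_cycle a b c \<equiv> transpose a b \<circ> transpose b c"

lemma three_cycle_permutes: "three_cycle a b c permutes {a, b, c}"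
  by (intro permutes_compose permutes_swap_id) auto

lemma evenperm_double_transposition:
  "a \<noteq> b \<Longrightarrow> c \<noteq> d \<Longrightarrow> evenperm (transpose a b \<circ> transpose c d)"
  by (simp add: evenperm_comp permutation_swap_id evenperm_swap)

lemma even_permutes_induct_three_cycles [consumes 3, case_names id three_cycle]:
  assumes "p permutes S" "finite S" "evenperm p"
    and base: "P id"
    and step: "\<And>a b c q. a \<in> S \<Longrightarrow> b \<in> S \<Longrightarrow> c \<in> S \<Longrightarrow> distinct [a, b, c] \<Longrightarrow> P q \<Longrightarrow>
      P (three_cycle a b c \<circ> q)"
  shows "P p"
  using assms(1-3)
proof (induction p rule: even_permutes_induct_transpositions)
  case id
  show ?case by fact
next
  case (swap a b c d q)
  have aux: "P (three_cycle a b c \<circ> q)"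
    if "a \<in> S" "b \<in> S" "c \<in> S" "a \<noteq> b" "b \<noteq> c" "P q" for a b c q
    using that step[of a b c q] by (cases "a = c") (auto simp: transpose_commute)
  show ?case
  proof (cases "b = c")
    case True
    with aux[of a b d q] swap show ?thesis by (simp add: o_def)
  next
    case False
    \<comment> \<open>Inserting \<open>transpose b c\<close> twice turns \<open>(a b)(c d)\<close>
      into the product of \<open>(a b)(b c)\<close> and \<open>(b c)(c d)\<close>.\<close>
    have "P (three_cycle a b c \<circ> (three_cycle b c d \<circ> q))"
      using aux[of b c d q] False swap by (intro aux) auto
    also have "three_cycle a b c \<circ> (three_cycle b c d \<circ> q) = transpose a b \<circ> (transpose c d \<circ> q)"
      by (simp add: fun_eq_iff)
    finally show ?thesis .
  qed
qed

text \<open>\<open>q\<close> fixes \<open>a\<close> and swaps \<open>b\<close> with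
  \<open>c\<close>, so conjugation by it inverts the 3-cycle \<open>p\<close>, and that inverse is
  the square of \<open>p\<close>. The factor \<open>transpose d e\<close> makes \<open>q\<close>
  even, whence the five points.\<close>

lemma three_cycle_eq_commutator:
  assumes "distinct [a, b, c, d, e]"
  defines "p \<equiv> three_cycle a b c" and "q \<equiv> transpose d e \<circ> transpose b c"
  shows "q \<circ> p = p \<circ> (p \<circ> q)"
proof
  fix x
  consider "x = a" | "x = b" | "x = c" | "x = d" | "x = e" | "x \<notin> {a, b, c, d, e}" by blast
  thus "(q \<circ> p) x = (p \<circ> (p \<circ> q)) x"
    by cases (use assms(1) in \<open>simp_all add: p_def q_def transpose_apply_other eq_commute\<close>)
qed

lemma permutes_comp_commute_disjoint:
  assumes "p permutes B" "inj u" "\<And>x. x \<in> B \<Longrightarrow> u x = x"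
  shows "u \<circ> p = p \<circ> u"
proof
  fix x
  show "(u \<circ> p) x = (p \<circ> u) x"
  proof (cases "x \<in> B")
    case True
    thus ?thesis using assms(3) permutes_in_image[OF assms(1), of x] by simp
  next
    case False
    hence "u x \<notin> B" using assms(2,3) by (metis injD)
    thus ?thesis using False permutes_not_in[OF assms(1)] by simp
  qed
qed

section \<open>Powers, cycles and centralizers\<close>

lemma funpow_comp_commute:
  assumes "f \<circ> g = g \<circ> f" shows "(f ^^ k) \<circ> g = g \<circ> (f ^^ k)"
  using assms by (induction k) (auto simp: fun_eq_iff)

lemma obtain_prime_order_funpow:
  assumes "permutation x" "x \<noteq> id"
  obtains p m where "nat_prime p" "x ^^ m \<noteq> id" "(x ^^ m) ^^ p = id"
proof -
  \<comment> \<open>\<open>N\<close> is the order of \<open>x\<close>. Dividing it by a prime factor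
    \<open>p\<close> gives an exponent \<open>m\<close> whose power is nontrivial by
    minimality.\<close>
  define N where "N = (LEAST N. N > 0 \<and> x ^^ N = id)"
  have "\<exists>N. N > 0 \<and> x ^^ N = id"
    using permutation_is_nilpotent[OF assms(1)] by metis
  hence N: "N > 0" "x ^^ N = id"
    unfolding N_def by (metis (mono_tags, lifting) LeastI)+
  have "N \<noteq> 1" using N(2) assms(2) by auto
  then obtain p where p: "nat_prime p" "p dvd N" using prime_factor_nat by blast
  then obtain m where m: "N = m * p" by (metis dvdE mult.commute)
  have "0 < m" "m < N" using m N(1) prime_gt_1_nat[OF p(1)] by auto
  hence "x ^^ m \<noteq> id"
    using not_less_Least[of m "\<lambda>N. N > 0 \<and> x ^^ N = id"] unfolding N_def by blast
  moreover have "(x ^^ m) ^^ p = id" using N(2) m by (simp add: funpow_mult mult.commute)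
  ultimately show thesis using that p(1) by blast
qed

lemma cycle_of_list_transitive:
  assumes "cycle cs" "x \<in> set cs" "y \<in> set cs"
  obtains k where "(cycle_of_list cs ^^ k) x = y"
proof -
  obtain i j where ij: "i < length cs" "x = cs ! i" "j < length cs" "y = cs ! j"
    using assms(2,3) by (metis in_set_conv_nth)
  \<comment> \<open>Adding \<open>length cs\<close> keeps the exponent clear of truncated
    subtraction when \<open>j < i\<close>; then \<open>k + i = length cs + j\<close>.\<close>
  define k where "k = length cs - i + j"
  have "(cycle_of_list cs ^^ k) x = map (cycle_of_list cs ^^ k) cs ! i"
    using ij by simp
  also have "\<dots> = cs ! ((k + i) mod length cs)"
    unfolding cyclic_rotation[OF assms(1)] using ij(1) by (simp add: nth_rotate)
  also have "(k + i) mod length cs = j" using ij by (simp add: k_def)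
  finally show thesis using that ij by blast
qed

lemma cycle_of_list_moves:
  assumes "cycle cs" "length cs \<ge> 2" "x \<in> set cs"
  shows "cycle_of_list cs x \<noteq> x"
proof
  assume fix_x: "cycle_of_list cs x = x"
  have "(cycle_of_list cs ^^ k) x = x" for k by (induction k) (simp_all add: fix_x)
  hence "set cs \<subseteq> {x}" using cycle_of_list_transitive[OF assms(1,3)] by (metis singletonI subsetI)
  hence "card (set cs) \<le> 1" using card_mono[of "{x}"] by simp
  thus False using assms(1,2) by (simp add: distinct_card)
qed

lemma evenperm_odd_cycle:
  assumes "cycle cs" "odd (length cs)"
  shows "evenperm (cycle_of_list cs)"
  using swapidseq_ext_imp_swapidseq[OF swapidseq_ext_of_cycles[OF assms(1)]] assms(2)
  by (simp add: evenperm_unique)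

text \<open>The only nonidentity permutation of two points is a transposition, which is odd. Hence
  the prime case may leave two points outside the cycle.\<close>

lemma even_permutes_card_le_2_eq_id:
  assumes "w permutes A" "finite A" "card A \<le> 2" "evenperm w"
  shows "w = id"
proof -
  obtain a b where "A \<subseteq> {a, b}"
  proof (cases "card A = 2")
    case True
    thus thesis using that by (metis card_2_iff order_refl)
  next
    case False
    hence "card A \<le> Suc 0" using assms(3) by simp
    thus thesis using that assms(2) by (metis card_le_Suc0_iff_eq equals0I insertCI subsetI)
  qed
  hence "w permutes {a, b}" using assms(1) permutes_subset by blast
  thus ?thesis using assms(4) by (auto simp: permutes_doubleton_iff evenperm_swap)
qed

text \<open>A permutation commuting with the cycle maps moved points to moved points, and its value
  at one of them determines it on all. Dividing by the matching power leaves an even permutation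
  \<open>w\<close> of at most two points.\<close>

lemma even_permutes_commuting_with_long_cycle:
  assumes cs: "cycle cs" "length cs \<ge> 2" "odd (length cs)" "set cs \<subseteq> S"
    and S: "finite S" "card (S - set cs) \<le> 2"
    and y: "y permutes S" "evenperm y" "y \<circ> cycle_of_list cs = cycle_of_list cs \<circ> y"
  obtains i where "y = cycle_of_list cs ^^ i"
proof -
  define c where "c = cycle_of_list cs"
  have c_perm: "c permutes set cs" unfolding c_def by (rule cycle_permutes)
  have pow: "y ((c ^^ k) x) = (c ^^ k) (y x)" for k x
    using funpow_comp_commute[of c y k] y(3) unfolding c_def by (metis comp_apply)
  obtain x where x: "x \<in> set cs" using cs(2) by (cases cs) auto
  have "c x \<noteq> x" unfolding c_def by (rule cycle_of_list_moves[OF cs(1,2) x])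
  hence "c (y x) \<noteq> y x"
    using pow[of 1 x] inj_eq[OF permutes_inj[OF y(1)], of "c x" x] by simp
  hence "y x \<in> set cs" using permutes_not_in[OF c_perm] by blast
  then obtain i where i: "(c ^^ i) x = y x"
    using cycle_of_list_transitive[OF cs(1) x] unfolding c_def by metis
  have eq: "y z = (c ^^ i) z" if "z \<in> set cs" for z
  proof -
    obtain k where "(c ^^ k) x = z"
      by (rule cycle_of_list_transitive[OF cs(1) x \<open>z \<in> set cs\<close>, folded c_def])
    thus ?thesis using pow[of k x] i by (metis add.commute comp_apply funpow_add)
  qed
  have ci: "(c ^^ i) permutes S"
    using permutes_funpow[OF c_perm] cs(4) permutes_subset by blast
  define w where "w = inv' (c ^^ i) \<circ> y"
  have "evenperm (c ^^ i)"
  proof (induction i)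
    case (Suc i)
    have "permutation c" "permutation (c ^^ i)"
      using permutation_of_cycle permutation_funpow unfolding c_def by blast+
    hence "evenperm (c \<circ> c ^^ i)"
      using Suc evenperm_odd_cycle[OF cs(1,3)] by (subst evenperm_comp) (simp_all add: c_def)
    thus ?case by (simp only: funpow.simps)
  qed simp
  moreover have perm: "permutation (c ^^ i)" "permutation y"
    using ci y(1) S(1) by (auto simp: permutation_permutes)
  ultimately have w_even: "evenperm w"
    unfolding w_def using y(2) by (simp add: evenperm_comp evenperm_inv permutation_inverse)
  have w_perm: "w permutes S" unfolding w_def using ci y(1) by (intro permutes_compose permutes_inv)
  have "w z = z" if "z \<in> set cs" for z
    using eq[OF that] permutes_inverses(2)[OF ci] by (simp add: w_def)
  hence "w permutes (S - set cs)" by (intro permutes_superset[OF w_perm]) auto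
  hence "w = id" using S w_even by (intro even_permutes_card_le_2_eq_id[of w "S - set cs"]) auto
  hence "y = c ^^ i"
    using permutes_inv_o(1)[OF ci] unfolding w_def by (metis comp_assoc comp_id id_comp)
  thus thesis using that unfolding c_def by blast
qed

text \<open>An exponent with nontrivial power is coprime to \<open>p\<close>, so Bezout gives it an
  inverse modulo \<open>p\<close>.\<close>

lemma funpow_prime_order_generator:
  assumes "nat_prime p" "c ^^ p = id" "c ^^ i \<noteq> id"
  obtains j where "(c ^^ i) ^^ j = c"
proof -
  have multiple: "c ^^ (p * k) = id" for k
    using assms(2) by (metis funpow_mult id_funpow)
  have "\<not> p dvd i" using assms(3) multiple by (metis dvdE)
  hence "i \<noteq> 0" by (metis dvd_0_right)
  moreover have "gcd i p = 1"
    using prime_imp_coprime[OF assms(1) \<open>\<not> p dvd i\<close>]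
    by (simp add: coprime_iff_gcd_eq_1 gcd.commute)
  ultimately obtain j k where "i * j = p * k + 1" using bezout_nat[of i p] by auto
  hence "c ^^ (i * j) = c" using multiple[of k] by (simp add: funpow_add)
  thus thesis using that by (simp add: funpow_mult mult.commute)
qed

section \<open>Orbits of a permutation of prime order\<close>

lemma support_of_prime_order:
  assumes "permutation x" "x ^^ p = id" "nat_prime p" "x a \<noteq> a"
  shows "card (set (support x a)) = p" "length (support x a) = p"
proof -
  \<comment> \<open>\<open>least_power x a\<close> is the length of the orbit of \<open>a\<close>;
    it divides \<open>p\<close> and exceeds 1 at a moved point.\<close>
  have "least_power x a dvd p" using assms(1,2) by (simp add: least_power_dvd)
  moreover have "least_power x a \<noteq> 1" using least_power_gt_one[OF assms(1,4)] by simp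
  ultimately have "least_power x a = p" using assms(3) by (auto simp: prime_nat_iff)
  thus "length (support x a) = p" by simp
  thus "card (set (support x a)) = p"
    using cycle_of_permutation[OF assms(1)] by (metis distinct_card)
qed

lemma support_subset:
  assumes "x permutes S" "x a \<noteq> a" shows "set (support x a) \<subseteq> S"
proof
  fix y assume "y \<in> set (support x a)"
  then obtain i where "y = (x ^^ i) a" by auto
  moreover have "a \<in> S" using permutes_not_in[OF assms(1)] assms(2) by blast
  ultimately show "y \<in> S" using permutes_in_image[OF permutes_funpow[OF assms(1)]] by simp
qed

lemma in_support: "permutation x \<Longrightarrow> a \<in> set (support x a)"
  using least_power_of_permutation(2)[of x a] by force

text \<open>The second factor is \<open>x\<close> switched off on the orbit of \<open>a\<close>; it
  is a permutation since the orbit and its complement are invariant.\<close>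

lemma split_off_cycle:
  assumes "x permutes S" "finite S"
  obtains r where "r permutes S - set (support x a)" "x = cycle_of_list (support x a) \<circ> r"
proof
  let ?O = "set (support x a)"
  define r where "r = (\<lambda>y. if y \<in> S - ?O then x y else y)"
  have perm: "permutation x" using assms by (auto simp: permutation_permutes)
  show r_perm: "r permutes S - ?O" unfolding r_def by (rule semidecomposition[OF assms])
  show "x = cycle_of_list (support x a) \<circ> r"
  proof
    fix y
    consider "y \<in> ?O" | "y \<in> S - ?O" | "y \<notin> S" "y \<notin> ?O" by blast
    thus "x y = (cycle_of_list (support x a) \<circ> r) y"
    proof cases
      case 1
      thus ?thesis using cycle_restrict[OF perm 1] by (simp add: r_def)
    next
      case 2
      hence "r y \<notin> ?O" using permutes_in_image[OF r_perm, of y] by blast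
      thus ?thesis using 2 id_outside_supp[of "r y" "support x a"] by (simp add: r_def)
    next
      case 3
      thus ?thesis using id_outside_supp[of y "support x a"] permutes_not_in[OF assms(1)]
        by (simp add: r_def)
    qed
  qed
qed

section \<open>Central extensions of alternating groups\<close>

lemma alt_group_pow: "x [^]\<^bsub>alt_group n\<^esub> (k::nat) = x ^^ k"
proof (induction k)
  case 0
  show ?case by (simp add: alt_group_one)
next
  case (Suc k)
  thus ?case by (simp add: alt_group_mult flip: funpow_Suc_right)
qed

lemma alt_group_noncommuting:
  assumes "n \<ge> 4" "x \<in> carrier (alt_group n)" "x \<noteq> id"
  obtains y where "y \<in> carrier (alt_group n)" "x \<circ> y \<noteq> y \<circ> x"
proof -
  have perm: "x permutes {1..n}" using assms(2) by (simp add: alt_group_carrier)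
  obtain a where a: "x a \<noteq> a" using assms(3) by (auto simp: fun_eq_iff)
  hence aS: "a \<in> {1..n}" using permutes_not_in[OF perm] by blast
  hence xS: "x a \<in> {1..n}" using permutes_in_image[OF perm] by blast
  have "card ({1..n} - {a, x a}) \<ge> 2"
    using assms(1) aS xS a by (simp add: card_Diff_subset)
  then obtain T where "T \<subseteq> {1..n} - {a, x a}" "card T = 2"
    using obtain_subset_with_card_n by metis
  then obtain c d where cd: "c \<in> {1..n} - {a, x a}" "d \<in> {1..n} - {a, x a}" "c \<noteq> d"
    by (auto simp: card_2_iff)
  \<comment> \<open>This 3-cycle fixes \<open>a\<close> and sends \<open>x a\<close> to
    \<open>c\<close>, so the two composites with \<open>x\<close> differ at
    \<open>a\<close>.\<close>
  define y where "y = three_cycle (x a) c d"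
  have "y permutes {1..n}"
    unfolding y_def by (rule permutes_subset[OF three_cycle_permutes]) (use cd xS in auto)
  moreover have "evenperm y"
    unfolding y_def by (rule evenperm_double_transposition) (use cd in auto)
  moreover have "(x \<circ> y) a = x a" "(y \<circ> x) a = c"
    using cd a by (auto simp: y_def transpose_apply_other)
  hence "(x \<circ> y) a \<noteq> (y \<circ> x) a" using cd by simp
  hence "x \<circ> y \<noteq> y \<circ> x" by metis
  ultimately show thesis using that by (simp add: alt_group_carrier)
qed

lemma obtain_three_elements:
  assumes "card A \<ge> 3"
  obtains a b c where "{a, b, c} \<subseteq> A" "distinct [a, b, c]"
proof -
  obtain T where "T \<subseteq> A" "card T = 3" using assms obtain_subset_with_card_n by metis
  thus thesis using that by (auto simp: card_3_iff)
qed

section \<open>The reduced deep commuting graph of the alternating group\<close>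

locale alt_central_extension = central_extension H "alt_group n" \<pi>
  for H (structure) and n and \<pi>
begin

abbreviation adj where "adj \<equiv> deep_adj (alt_group n) H \<pi>"
abbreviation vertices where "vertices \<equiv> reduced_vertices (carrier (alt_group n)) adj"
abbreviation reach where "reach \<equiv> (\<lambda>a b. a \<in> vertices \<and> b \<in> vertices \<and> adj a b)\<^sup>*\<^sup>*"

lemma adj_iff:
  "adj x y \<longleftrightarrow>
     x \<in> carrier (alt_group n) \<and> y \<in> carrier (alt_group n) \<and> x \<noteq> y \<and> lifts_commute x y"
  by (auto simp: deep_adj_def lifts_commute_def)

text \<open>The identity lifts to the identity of \<open>H\<close>, so it is dominant. Nothing else
  is: the alternating group has trivial center for \<open>n >= 4\<close>, and noncommuting elements
  have noncommuting lifts.\<close>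

lemma vertices_eq:
  assumes "n \<ge> 4" shows "vertices = carrier (alt_group n) - {id}"
proof (intro equalityI subsetI)
  fix x assume "x \<in> vertices"
  moreover have "adj id y" if "y \<in> carrier (alt_group n)" "y \<noteq> id" for y
    using that lifts_commute_sym[OF lifts_commute_one[of y]] H.one_closed
    by (auto simp: adj_iff alt_group_one)
  hence "dominant (carrier (alt_group n)) adj id"
    using H.one_closed by (auto simp: dominant_def alt_group_one)
  ultimately show "x \<in> carrier (alt_group n) - {id}" by (auto simp: reduced_vertices_def)
next
  fix x assume x: "x \<in> carrier (alt_group n) - {id}"
  then obtain y where y: "y \<in> carrier (alt_group n)" "x \<circ> y \<noteq> y \<circ> x"
    using alt_group_noncommuting[OF assms] by blast
  hence "\<not> adj x y" "y \<noteq> x"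
    using lifts_commute_imp_commute[of x y] by (auto simp: adj_iff alt_group_mult)
  thus "x \<in> vertices" using x y by (auto simp: reduced_vertices_def dominant_def)
qed

lemma reach_sym: "reach x y \<Longrightarrow> reach y x"
proof (rule sympD[OF symp_rtranclp])
  show "symp (\<lambda>a b. a \<in> vertices \<and> b \<in> vertices \<and> adj a b)"
    by (auto intro!: sympI simp: adj_iff lifts_commute_sym)
qed

lemma reach_trans: "reach x y \<Longrightarrow> reach y z \<Longrightarrow> reach x z"
  by (rule rtranclp_trans)

lemma reach_lifts_commute:
  assumes "n \<ge> 4" "x \<in> carrier (alt_group n)" "y \<in> carrier (alt_group n)" "x \<noteq> id" "y \<noteq> id"
    and "lifts_commute x y"
  shows "reach x y"
proof (cases "x = y")
  case False
  have "x \<in> vertices \<and> y \<in> vertices \<and> adj x y"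
    using assms False by (simp add: vertices_eq adj_iff)
  thus ?thesis
    using r_into_rtranclp[of "\<lambda>a b. a \<in> vertices \<and> b \<in> vertices \<and> adj a b" x y] by blast
qed simp

section \<open>Disconnection caused by a prime among \<open>n\<close>, \<open>n - 1\<close>,
  \<open>n - 2\<close>\<close>

lemma prime_imp_disconnected:
  assumes "n \<ge> 8" "nat_prime p" "p \<le> n" "n \<le> p + 2"
  shows "\<not> connected_induced vertices adj"
proof
  assume conn: "connected_induced vertices adj"
  have "n \<ge> 4" "p \<ge> 6" using assms by auto
  have odd_p: "odd p" using \<open>p \<ge> 6\<close> prime_odd_nat[OF assms(2)] by simp
  define cs where "cs = [1..<Suc p]"
  define c where "c = cycle_of_list cs"
  have cs: "cycle cs" "length cs = p" "set cs = {1..p}"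
    unfolding cs_def by auto
  have c_carrier: "c \<in> carrier (alt_group n)"
    unfolding alt_group_carrier c_def
    using permutes_subset[OF cycle_permutes, of cs "{1..n}"] evenperm_odd_cycle[OF cs(1)]
      cs assms(3) odd_p by auto
  have "c 1 \<noteq> 1"
    unfolding c_def by (rule cycle_of_list_moves[OF cs(1)]) (use cs \<open>p \<ge> 6\<close> in auto)
  hence "c \<noteq> id" by auto
  have c_pow: "c ^^ p = id" using cycle_is_id_root[OF cs(1)] cs(2) by (simp add: c_def)
  have "card ({1..n} - set cs) \<le> 2"
    using assms(3,4) by (simp add: cs(3) card_Diff_subset)
  hence centralizer: "\<exists>i. y = c ^^ i" if "y \<in> carrier (alt_group n)" "y \<circ> c = c \<circ> y" for y
    using even_permutes_commuting_with_long_cycle[OF cs(1), of "{1..n}" y]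
      that cs assms(3) odd_p \<open>p \<ge> 6\<close> unfolding alt_group_carrier c_def by fastforce
  \<comment> \<open>Being a power of \<open>c\<close> is preserved along edges, so the component of
    \<open>c\<close> stays inside the subgroup generated by \<open>c\<close>.\<close>
  have closed: "\<exists>i. y = c ^^ i" if "reach c y" for y
    using that
  proof (induction rule: rtranclp_induct)
    case base
    show ?case by (rule exI[of _ 1]) simp
  next
    case (step x y)
    then obtain i where i: "x = c ^^ i" by blast
    \<comment> \<open>Vertices exclude the identity, so \<open>x\<close> generates the same subgroup
      as \<open>c\<close>, and whatever commutes with \<open>x\<close> commutes with
      \<open>c\<close>.\<close>
    have "x \<noteq> id" using step(2) vertices_eq[OF \<open>n \<ge> 4\<close>] by blast
    then obtain j where j: "x ^^ j = c"
      using funpow_prime_order_generator[OF assms(2) c_pow] i by metis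
    have y: "y \<in> carrier (alt_group n)" "x \<circ> y = y \<circ> x"
      using step(2) lifts_commute_imp_commute[of x y] by (auto simp: adj_iff alt_group_mult)
    have "c \<circ> y = y \<circ> c" using funpow_comp_commute[OF y(2), of j] j by simp
    thus ?case using centralizer[OF y(1)] by simp
  qed
  \<comment> \<open>A vertex outside that subgroup: it fixes 1 and moves 2, whereas a power of
    \<open>c\<close> fixing one point of the cycle fixes them all.\<close>
  define t where "t = three_cycle 2 3 (4::nat)"
  have "t permutes {1..n}"
    unfolding t_def by (rule permutes_subset[OF three_cycle_permutes]) (use \<open>n \<ge> 4\<close> in auto)
  hence t_carrier: "t \<in> carrier (alt_group n)"
    unfolding alt_group_carrier by (simp add: t_def evenperm_double_transposition)
  have t: "t 1 = 1" "t 2 = 3" by (simp_all add: t_def transpose_def)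
  hence "t \<noteq> id" by auto
  hence "reach c t"
    using conn c_carrier t_carrier \<open>c \<noteq> id\<close> vertices_eq[OF \<open>n \<ge> 4\<close>]
    unfolding connected_induced_def by blast
  then obtain i where i: "t = c ^^ i" using closed by blast
  obtain k where k: "(c ^^ k) 1 = 2"
    using cycle_of_list_transitive[OF cs(1), of 1 2] cs(3) \<open>p \<ge> 6\<close> unfolding c_def by auto
  have "t 2 = (c ^^ k) (t 1)"
    unfolding i k[symmetric] by (metis add.commute comp_apply funpow_add)
  thus False using t k by simp
qed

text \<open>Five points make every 3-cycle on \<open>B\<close> a commutator of even permutations of
  \<open>B\<close>, all of which commute with \<open>u\<close>. So its lifts commute with those of
  \<open>u\<close>, and 3-cycles generate the even permutations of \<open>B\<close>.\<close>

lemma lifts_commute_disjoint: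
  assumes u: "u \<in> carrier (alt_group n)" and B: "B \<subseteq> {1..n}" "card B \<ge> 5" "\<And>x. x \<in> B \<Longrightarrow> u x = x"
    and v: "v permutes B" "evenperm v"
  shows "lifts_commute u v"
proof -
  have "finite B" using B(1) finite_subset by blast
  have carrier: "p \<in> carrier (alt_group n)" if "p permutes B" "evenperm p" for p
    using permutes_subset[OF that(1) B(1)] that(2) by (simp add: alt_group_carrier)
  have "inj u" using u permutes_inj by (auto simp: alt_group_carrier)
  note comm = permutes_comp_commute_disjoint[OF _ this B(3)]
  show ?thesis
    using v(1) \<open>finite B\<close> v(2)
  proof (induction v rule: even_permutes_induct_three_cycles)
    case id
    show ?case using lifts_commute_one[OF u] by (simp add: alt_group_one id_def)
  next
    case (three_cycle a b c q)
    have "card (B - {a, b, c}) \<ge> 2"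
      using three_cycle B(2) \<open>finite B\<close> by (simp add: card_Diff_subset)
    then obtain T where "T \<subseteq> B - {a, b, c}" "card T = 2"
      using obtain_subset_with_card_n by metis
    then obtain d e where de: "d \<in> B - {a, b, c}" "e \<in> B - {a, b, c}" "d \<noteq> e"
      by (auto simp: card_2_iff)
    let ?p = "three_cycle a b c" and ?s = "transpose d e \<circ> transpose b c"
    have p: "?p permutes B" "evenperm ?p"
      using three_cycle permutes_subset[OF three_cycle_permutes[of a b c], of B]
      by (auto simp: evenperm_double_transposition)
    have s: "?s permutes B" "evenperm ?s"
      using three_cycle de by (auto intro!: permutes_compose permutes_swap_id evenperm_double_transposition)
    have "?s \<circ> ?p = ?p \<circ> (?p \<circ> ?s)"
      by (rule three_cycle_eq_commutator) (use three_cycle(4) de in auto)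
    hence "lifts_commute u ?p"
      using lifts_commute_commutator[OF u carrier[OF p] carrier[OF s] carrier[OF p]]
        comm[OF p(1)] comm[OF s(1)] unfolding alt_group_mult by blast
    hence "lifts_commute u (?p \<circ> q)"
      using lifts_commute_mult[OF _ three_cycle(5), of ?p] unfolding alt_group_mult by blast
    thus ?case by (simp add: o_def)
  qed
qed

section \<open>Joining vertices to 3-cycles\<close>

lemma three_cycle_in_carrier:
  "{a, b, c} \<subseteq> {1..n} \<Longrightarrow> distinct [a, b, c] \<Longrightarrow> three_cycle a b c \<in> carrier (alt_group n)"
  using permutes_subset[OF three_cycle_permutes, of a b c "{1..n}"]
  by (simp add: alt_group_carrier evenperm_double_transposition)

lemma three_cycle_neq_id: "distinct [a, b, c] \<Longrightarrow> three_cycle a b c \<noteq> id"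
  by (metis comp_apply distinct_length_2_or_more id_apply transpose_apply_first
      transpose_apply_second transpose_apply_other)

text \<open>Here the 3-cycle plays the part of the permutation fixing a large set pointwise, and
  \<open>x\<close> is an even permutation of the other \<open>n - 3 >= 5\<close> points.\<close>

lemma reach_three_cycle:
  assumes "n \<ge> 8" "x \<in> carrier (alt_group n)" "x \<noteq> id"
    and "{a, b, c} \<subseteq> {1..n}" "distinct [a, b, c]" "\<And>y. y \<in> {a, b, c} \<Longrightarrow> x y = y"
  shows "reach x (three_cycle a b c)"
proof -
  have x: "x permutes {1..n}" "evenperm x" using assms(2) by (auto simp: alt_group_carrier)
  have "lifts_commute (three_cycle a b c) x"
  proof (rule lifts_commute_disjoint[of _ "{1..n} - {a, b, c}"])
    show "card ({1..n} - {a, b, c}) \<ge> 5"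
      using assms(1,4,5) by (simp add: card_Diff_subset)
    show "x permutes {1..n} - {a, b, c}"
      by (rule permutes_superset[OF x(1)]) (use assms(6) in auto)
    show "three_cycle a b c y = y" if "y \<in> {1..n} - {a, b, c}" for y
      using that permutes_not_in[OF three_cycle_permutes[of a b c], of y] by blast
  qed (use x three_cycle_in_carrier assms(4,5) in auto)
  thus ?thesis
    using assms three_cycle_in_carrier[of a b c] three_cycle_neq_id[of a b c]
    by (intro reach_lifts_commute lifts_commute_sym[of "three_cycle a b c"]) auto
qed

text \<open>3-cycles serve as a hub: it suffices that each vertex reaches one of them and that any
  two of them are joined.\<close>

definition near_three_cycle where
  "near_three_cycle x \<longleftrightarrow>
     (\<exists>a b c. {a, b, c} \<subseteq> {1..n} \<and> distinct [a, b, c] \<and> reach x (three_cycle a b c))"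

lemma near_three_cycle_if_fixed:
  assumes "n \<ge> 8" "x \<in> carrier (alt_group n)" "x \<noteq> id"
    and "F \<subseteq> {1..n}" "card F \<ge> 3" "\<And>y. y \<in> F \<Longrightarrow> x y = y"
  shows "near_three_cycle x"
proof -
  obtain a b c where abc: "{a, b, c} \<subseteq> F" "distinct [a, b, c]"
    using obtain_three_elements[OF assms(5)] .
  have "reach x (three_cycle a b c)"
    by (rule reach_three_cycle[OF assms(1-3)]) (use abc assms in auto)
  thus ?thesis using abc assms(4) unfolding near_three_cycle_def by blast
qed

lemma near_three_cycle_if_reach:
  "reach x y \<Longrightarrow> near_three_cycle y \<Longrightarrow> near_three_cycle x"
  unfolding near_three_cycle_def using reach_trans by blast

text \<open>With at most two fixed points, no 3-cycle disjoint from \<open>x\<close> is at hand. The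
  product of a 3-cycle and its conjugate under \<open>x\<close> commutes with \<open>x\<close>; its
  square has commuting lifts and moves only six points.\<close>

lemma near_three_cycle_involution:
  assumes "n \<ge> 10" "x \<in> carrier (alt_group n)" "x \<circ> x = id" "x \<noteq> id"
    and few: "card {y \<in> {1..n}. x y = y} \<le> 2"
  shows "near_three_cycle x"
proof -
  have x: "x permutes {1..n}" "evenperm x" using assms(2) by (auto simp: alt_group_carrier)
  have xx: "x (x y) = y" for y using assms(3) by (metis comp_apply id_apply)
  define M where "M = {1..n} - {y \<in> {1..n}. x y = y}"
  have "card M = n - card {y \<in> {1..n}. x y = y}"
    unfolding M_def by (subst card_Diff_subset) auto
  hence M: "finite M" "card M \<ge> 8" using few assms(1) by (auto simp: M_def)
  \<comment> \<open>At least eight points are moved, so \<open>a\<close>, \<open>b\<close>,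
    \<open>c\<close> can be taken from three different 2-cycles of \<open>x\<close> by avoiding the
    points already used.\<close>
  have pick: "\<exists>y. y \<in> M - set ys" if "length ys \<le> 7" for ys
  proof -
    have "card (set ys) < card M" using card_length[of ys] that M(2) by linarith
    hence "\<not> M \<subseteq> set ys" using card_mono[of "set ys" M] by auto
    thus ?thesis by blast
  qed
  obtain a where a: "a \<in> M" using pick[of "[]"] by auto
  obtain b where b: "b \<in> M" "b \<noteq> a" "b \<noteq> x a" using pick[of "[a, x a]"] by auto
  obtain c where c: "c \<in> M" "c \<noteq> a" "c \<noteq> x a" "c \<noteq> b" "c \<noteq> x b"
    using pick[of "[a, x a, b, x b]"] by auto
  have moved: "x y \<noteq> y" "y \<in> {1..n}" "x y \<in> {1..n}" if "y \<in> M" for y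
    using that permutes_in_image[OF x(1)] by (auto simp: M_def)
  define A where "A = {a, b, c}"
  have "x b \<noteq> a" "x c \<noteq> a" "x c \<noteq> b" using b(3) c(3,5) xx by metis+
  hence disj: "A \<inter> x ` A = {}"
    using moved(1)[OF a] moved(1)[OF b(1)] moved(1)[OF c(1)] b c by (auto simp: A_def)
  \<comment> \<open>As \<open>x\<close> is its own inverse, \<open>t'\<close> is the conjugate of
    \<open>t\<close>, a 3-cycle on the disjoint image of \<open>A\<close>. Conjugation by
    \<open>x\<close> exchanges the commuting factors of \<open>w\<close>, hence fixes
    \<open>w\<close>.\<close>
  define t t' w where "t = three_cycle a b c" and "t' = x \<circ> t \<circ> x" and "w = t \<circ> t'"
  have A_sub: "A \<subseteq> {1..n}" "x ` A \<subseteq> {1..n}"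
    using moved a b(1) c(1) by (auto simp: A_def)
  have t: "t permutes A" unfolding t_def A_def by (rule three_cycle_permutes)
  have t_carrier: "t \<in> carrier (alt_group n)"
    unfolding t_def by (rule three_cycle_in_carrier) (use A_sub b c in \<open>auto simp: A_def\<close>)
  have t'_carrier: "t' \<in> carrier (alt_group n)"
    using H.m_closed[OF H.m_closed[OF assms(2) t_carrier] assms(2)]
    by (simp add: t'_def alt_group_mult)
  have w_carrier: "w \<in> carrier (alt_group n)"
    using H.m_closed[OF t_carrier t'_carrier] by (simp add: w_def alt_group_mult)
  have t'_fix: "t' y = y" if "y \<notin> x ` A" for y
  proof -
    have "x y \<notin> A" using that xx by (metis imageI)
    thus ?thesis using permutes_not_in[OF t] xx by (simp add: t'_def)
  qed
  have "inj t'" using t'_carrier permutes_inj unfolding alt_group_carrier by blast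
  hence tt': "t' \<circ> t = t \<circ> t'"
    by (rule permutes_comp_commute_disjoint[OF t]) (use t'_fix disj in blast)
  have "x \<circ> w = t' \<circ> t \<circ> x" "w \<circ> x = t \<circ> t' \<circ> x"
    by (simp_all add: fun_eq_iff w_def t'_def xx)
  hence xw: "x \<circ> w = w \<circ> x" unfolding tt' by (simp add: fun_eq_iff w_def t'_def xx)
  define y where "y = w \<circ> w"
  have y_carrier: "y \<in> carrier (alt_group n)"
    using H.m_closed[OF w_carrier w_carrier] by (simp add: y_def alt_group_mult)
  have w_eq: "w z = t z" if "z \<in> A" for z
  proof -
    have "z \<notin> x ` A" using that disj by blast
    thus ?thesis using t'_fix by (simp add: w_def)
  qed
  \<comment> \<open>Nontriviality of the square shows at \<open>a\<close>, where \<open>w\<close>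
    acts twice as \<open>t\<close>.\<close>
  have "y a = c"
  proof -
    have "t a = b" "t b = c" using b c by (auto simp: t_def transpose_def)
    thus ?thesis using w_eq[of a] w_eq[of b] by (simp add: y_def A_def)
  qed
  hence "y \<noteq> id" using c by auto
  have "lifts_commute x y"
    using lifts_commute_square[OF assms(2) w_carrier] assms(3) xw
    by (simp add: alt_group_mult alt_group_one y_def)
  hence "reach x y"
    using assms y_carrier \<open>y \<noteq> id\<close> by (intro reach_lifts_commute) auto
  moreover have "near_three_cycle y"
  proof (rule near_three_cycle_if_fixed[of _ "{1..n} - (A \<union> x ` A)"])
    have "card (A \<union> x ` A) \<le> card A + card (x ` A)" by (rule card_Un_le)
    also have "card A \<le> 3" unfolding A_def by (simp add: card_insert_if)
    also have "card (x ` A) \<le> 3" unfolding A_def by (simp add: card_insert_if)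
    finally have "card (A \<union> x ` A) \<le> 6" by simp
    moreover have "finite A" by (simp add: A_def)
    ultimately show "3 \<le> card ({1..n} - (A \<union> x ` A))"
      using A_sub assms(1) by (simp add: card_Diff_subset)
    fix z assume "z \<in> {1..n} - (A \<union> x ` A)"
    hence "w z = z" using t'_fix[of z] permutes_not_in[OF t, of z] by (simp add: w_def)
    thus "y z = z" by (simp add: y_def)
  qed (use assms(1) y_carrier \<open>y \<noteq> id\<close> in auto)
  ultimately show ?thesis by (rule near_three_cycle_if_reach)
qed

text \<open>Outside one \<open>p\<close>-cycle \<open>c\<close> there are more than two points and
  at most two are fixed, so a second \<open>p\<close>-cycle exists. Thus \<open>c\<close> has many
  fixed points, and its lifts commute with those of \<open>x\<close>, the product of
  \<open>c\<close> and a disjoint even \<open>r\<close>.\<close>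

lemma near_three_cycle_odd_prime:
  assumes "n \<ge> 10" "x \<in> carrier (alt_group n)" "x ^^ p = id" "x \<noteq> id" "nat_prime p" "odd p"
    and not_long: "\<not> n \<le> p + 2"
    and few: "card {y \<in> {1..n}. x y = y} \<le> 2"
  shows "near_three_cycle x"
proof -
  have x: "x permutes {1..n}" "evenperm x" using assms(2) by (auto simp: alt_group_carrier)
  have perm: "permutation x" using x(1) by (auto simp: permutation_permutes)
  obtain a where a: "x a \<noteq> a" using assms(4) by (auto simp: fun_eq_iff)
  define orb where "orb a = set (support x a)" for a
  have orb: "orb a \<subseteq> {1..n}" "card (orb a) = p" if "x a \<noteq> a" for a
    unfolding orb_def
    by (rule support_subset[OF x(1) that], rule support_of_prime_order[OF perm assms(3,5) that])
  define C where "C = {1..n} - orb a"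
  have "card C = card {1..n} - card (orb a)"
    unfolding C_def by (rule card_Diff_subset[OF finite_subset[OF orb(1)[OF a]] orb(1)[OF a]]) simp
  hence card_C: "card C = n - p" using orb(2)[OF a] by simp
  have "\<not> C \<subseteq> {y \<in> {1..n}. x y = y}"
  proof
    assume "C \<subseteq> {y \<in> {1..n}. x y = y}"
    hence "card C \<le> card {y \<in> {1..n}. x y = y}" by (intro card_mono) simp_all
    thus False using few card_C not_long by linarith
  qed
  then obtain b where b: "b \<notin> orb a" "x b \<noteq> b" unfolding C_def by blast
  have "orb b \<inter> orb a = {}" using disjoint_support'[OF perm] b(1) unfolding orb_def by blast
  hence "orb b \<subseteq> C" using orb(1)[OF b(2)] unfolding C_def by blast
  hence "p \<le> card C" using orb(2)[OF b(2)] card_mono[of C "orb b"] by (simp add: C_def)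
  \<comment> \<open>The second orbit gives \<open>p <= n - p\<close>, so the complement
    \<open>C\<close> holds at least half of the \<open>n >= 10\<close> points.\<close>
  hence C5: "card C \<ge> 5" using card_C assms(1) by linarith
  define c where "c = cycle_of_list (support x a)"
  obtain r where r: "r permutes C" "x = c \<circ> r"
    using split_off_cycle[OF x(1), of a] unfolding C_def c_def orb_def by auto
  have c_perm: "c permutes orb a" unfolding c_def orb_def by (rule cycle_permutes)
  have c_even: "evenperm c"
    unfolding c_def
    by (rule evenperm_odd_cycle[OF cycle_of_permutation[OF perm]])
      (use support_of_prime_order(2)[OF perm assms(3,5) a] assms(6) in simp)
  have c_carrier: "c \<in> carrier (alt_group n)"
    using permutes_subset[OF c_perm orb(1)[OF a]] c_even by (simp add: alt_group_carrier)
  have c_fix: "c y = y" if "y \<in> C" for y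
    using that permutes_not_in[OF c_perm] unfolding C_def by blast
  have "r permutes {1..n}" by (rule permutes_subset[OF r(1)]) (simp add: C_def)
  hence "permutation r" by (auto simp: permutation_permutes)
  moreover have "permutation c" unfolding c_def by (rule permutation_of_cycle)
  ultimately have "evenperm r" using x(2) c_even unfolding r(2) by (simp add: evenperm_comp)
  hence "lifts_commute c r"
    using c_carrier c_fix C5 r(1) by (intro lifts_commute_disjoint[of c C]) (auto simp: C_def)
  hence "lifts_commute c x"
    using lifts_commute_mult[OF lifts_commute_refl[OF c_carrier]] by (simp add: r(2) alt_group_mult)
  moreover have "c a = x a" unfolding c_def using cycle_restrict[OF perm in_support[OF perm]] by simp
  hence "c \<noteq> id" using a by auto
  ultimately have "reach x c"
    using assms c_carrier by (intro reach_lifts_commute lifts_commute_sym[of c]) auto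
  moreover have "near_three_cycle c"
    by (rule near_three_cycle_if_fixed[of _ C])
      (use assms(1) c_carrier \<open>c \<noteq> id\<close> C5 c_fix in \<open>auto simp: C_def\<close>)
  ultimately show ?thesis by (rule near_three_cycle_if_reach)
qed

text \<open>Each vertex is joined to a power of prime order \<open>p\<close>, whose nontrivial
  cycles all have length \<open>p\<close>. The number of fixed points and the parity of
  \<open>p\<close> then select the route.\<close>

lemma near_three_cycle:
  assumes "n \<ge> 10" "x \<in> carrier (alt_group n)" "x \<noteq> id"
    and no_prime: "\<And>p. nat_prime p \<Longrightarrow> p \<le> n \<Longrightarrow> \<not> n \<le> p + 2"
  shows "near_three_cycle x"
proof -
  obtain p m where p: "nat_prime p" "x ^^ m \<noteq> id" "(x ^^ m) ^^ p = id"
    using obtain_prime_order_funpow[OF alt_group_carrier'[OF assms(2)] assms(3)] .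
  define z where "z = x ^^ m"
  have z: "z \<in> carrier (alt_group n)"
    using H.nat_pow_closed[OF assms(2), of m] by (simp add: z_def alt_group_pow)
  have "lifts_commute x z"
    using lifts_commute_pow[OF assms(2) lifts_commute_refl[OF assms(2)], of m]
    by (simp add: z_def alt_group_pow)
  hence "reach x z"
    using assms z p(2) by (intro reach_lifts_commute) (auto simp: z_def)
  moreover have "near_three_cycle z"
  proof (cases "card {y \<in> {1..n}. z y = y} \<le> 2")
    case False
    thus ?thesis
      using assms(1) z p(2)
      by (intro near_three_cycle_if_fixed[of z "{y \<in> {1..n}. z y = y}"]) (auto simp: z_def)
  next
    case few: True
    show ?thesis
    proof (cases "p = 2")
      case True
      hence "z \<circ> z = id" using p(3) by (simp add: z_def numeral_2_eq_2)
      thus ?thesis using near_three_cycle_involution[OF assms(1) z] few p(2) by (simp add: z_def)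
    next
      case False
      hence "odd p" using p(1) prime_odd_nat prime_ge_2_nat by (metis le_neq_implies_less)
      have perm: "permutation z" using alt_group_carrier'[OF z] .
      \<comment> \<open>An orbit of size \<open>p\<close> lies inside \<open>{1..n}\<close>. With
        this bound \<open>no_prime\<close> yields \<open>n > p + 2\<close>, ruling out a single long
        cycle.\<close>
      have "p \<le> n"
      proof -
        obtain a where a: "z a \<noteq> a" using p(2) by (auto simp: z_def fun_eq_iff)
        have "set (support z a) \<subseteq> {1..n}"
          using support_subset[of z "{1..n}" a] a z unfolding alt_group_carrier by blast
        hence "card (set (support z a)) \<le> n" using card_mono[of "{1..n}"] by fastforce
        thus ?thesis
          using support_of_prime_order(1)[of z p a] perm a p(1,3) unfolding z_def by metis
      qed
      thus ?thesis
        using near_three_cycle_odd_prime[OF assms(1) z _ _ p(1) \<open>odd p\<close> no_prime[OF p(1)] few] p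
        by (simp add: z_def)
    qed
  qed
  ultimately show ?thesis by (rule near_three_cycle_if_reach)
qed

text \<open>Two 3-cycles cover at most six of at least ten points, so a 3-cycle disjoint from both
  can serve as an intermediate vertex.\<close>

lemma reach_three_cycles:
  assumes "n \<ge> 10" "{a, b, c} \<subseteq> {1..n}" "distinct [a, b, c]" "{d, e, f} \<subseteq> {1..n}" "distinct [d, e, f]"
  shows "reach (three_cycle a b c) (three_cycle d e f)"
proof -
  have "card ({a, b, c} \<union> {d, e, f}) \<le> 6"
    by (rule order_trans[OF card_Un_le]) (simp add: card_insert_if)
  moreover have "card ({1..n} - ({a, b, c} \<union> {d, e, f})) = n - card ({a, b, c} \<union> {d, e, f})"
    by (subst card_Diff_subset) (use assms in simp_all)
  ultimately have "card ({1..n} - ({a, b, c} \<union> {d, e, f})) \<ge> 3"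
    using assms(1) by linarith
  then obtain u v w where uvw: "{u, v, w} \<subseteq> {1..n} - ({a, b, c} \<union> {d, e, f})" "distinct [u, v, w]"
    by (rule obtain_three_elements)
  have *: "reach (three_cycle i j k) (three_cycle u v w)"
    if ijk: "{i, j, k} \<subseteq> {1..n}" "distinct [i, j, k]" "{u, v, w} \<inter> {i, j, k} = {}" for i j k
  proof (rule reach_three_cycle)
    show "n \<ge> 8" using assms(1) by simp
    show "three_cycle i j k \<in> carrier (alt_group n)" by (rule three_cycle_in_carrier[OF ijk(1,2)])
    show "three_cycle i j k \<noteq> id" by (rule three_cycle_neq_id[OF ijk(2)])
    show "{u, v, w} \<subseteq> {1..n}" using uvw(1) by blast
    show "distinct [u, v, w]" by fact
    show "three_cycle i j k y = y" if "y \<in> {u, v, w}" for y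
      using that ijk(3) permutes_not_in[OF three_cycle_permutes[of i j k], of y] by blast
  qed
  have "reach (three_cycle a b c) (three_cycle u v w)"
    by (rule *[OF assms(2,3)]) (use uvw(1) in blast)
  moreover have "reach (three_cycle d e f) (three_cycle u v w)"
    by (rule *[OF assms(4,5)]) (use uvw(1) in blast)
  ultimately show ?thesis using reach_trans[OF _ reach_sym] by blast
qed

lemma no_prime_imp_connected:
  assumes "n \<ge> 10" "\<And>p. nat_prime p \<Longrightarrow> p \<le> n \<Longrightarrow> \<not> n \<le> p + 2"
  shows "connected_induced vertices adj"
  unfolding connected_induced_def
proof (intro ballI)
  fix x y assume "x \<in> vertices" "y \<in> vertices"
  moreover have "vertices = carrier (alt_group n) - {id}" using assms(1) by (intro vertices_eq) simp
  ultimately have "near_three_cycle x" "near_three_cycle y"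
    using near_three_cycle[OF assms(1) _ _ assms(2)] by blast+
  obtain a b c where abc: "{a, b, c} \<subseteq> {1..n}" "distinct [a, b, c]" "reach x (three_cycle a b c)"
    using \<open>near_three_cycle x\<close> unfolding near_three_cycle_def by blast
  obtain d e f where def: "{d, e, f} \<subseteq> {1..n}" "distinct [d, e, f]" "reach y (three_cycle d e f)"
    using \<open>near_three_cycle y\<close> unfolding near_three_cycle_def by blast
  show "reach x y"
    by (rule reach_trans[OF abc(3) reach_trans[OF reach_three_cycles reach_sym[OF def(3)]]])
      (fact assms(1) abc def)+
qed

end

theorem theorem5p27:
  fixes n :: nat and H :: "('b, 'c) monoid_scheme" and \<pi> :: "'b \<Rightarrow> nat \<Rightarrow> nat"
  assumes "n \<ge> 8"
    and "schur_cover (alt_group n) H \<pi>"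
  shows "connected_induced
           (reduced_vertices (carrier (alt_group n)) (deep_adj (alt_group n) H \<pi>))
           (deep_adj (alt_group n) H \<pi>)
         \<longleftrightarrow> \<not> nat_prime n \<and> \<not> nat_prime (n - 1) \<and> \<not> nat_prime (n - 2)"
proof -
  have stem: "group H" "\<pi> \<in> hom H (alt_group n)" "\<pi> ` carrier H = carrier (alt_group n)"
    "kernel H (alt_group n) \<pi> \<subseteq> group_center H"
    using assms(2) unfolding schur_cover_def stem_extension_def by blast+
  hence "group_hom H (alt_group n) \<pi>"
    by (simp add: group_hom_def group_hom_axioms_def alt_group_is_group)
  with stem have "central_extension H (alt_group n) \<pi>"
    by (simp add: central_extension_def central_extension_axioms_def)
  then interpret alt_central_extension H n \<pi>
    by (rule alt_central_extension.intro)
  \<comment> \<open>The bounds \<open>p <= n\<close> and \<open>n <= p + 2\<close> treat the three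
    cases uniformly, without truncated subtraction.\<close>
  have primes: "(\<exists>p. nat_prime p \<and> p \<le> n \<and> n \<le> p + 2) \<longleftrightarrow>
    nat_prime n \<or> nat_prime (n - 1) \<or> nat_prime (n - 2)" (is "?L \<longleftrightarrow> ?R")
  proof
    assume ?L
    then obtain p where p: "nat_prime p" "p \<le> n" "n \<le> p + 2" by blast
    hence "p = n \<or> p = n - 1 \<or> p = n - 2" by linarith
    thus ?R using p(1) by blast
  next
    assume ?R
    then obtain p where "nat_prime p" "p = n \<or> p = n - 1 \<or> p = n - 2" by blast
    moreover have "p \<le> n" "n \<le> p + 2" using calculation(2) by linarith+
    ultimately show ?L by blast
  qed
  show ?thesis
  proof
    assume "connected_induced vertices adj"
    thus "\<not> nat_prime n \<and> \<not> nat_prime (n - 1) \<and> \<not> nat_prime (n - 2)"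
      using prime_imp_disconnected[OF assms(1)] primes by blast
  next
    assume np: "\<not> nat_prime n \<and> \<not> nat_prime (n - 1) \<and> \<not> nat_prime (n - 2)"
    \<comment> \<open>Since 7 is both \<open>8 - 1\<close> and \<open>9 - 2\<close>, the values 8
      and 9 are excluded, which gives the bound \<open>n >= 10\<close> of the connectivity
      argument.\<close>
    have "nat_prime 7" by (simp add: prime_nat_numeral_eq)
    hence "n \<noteq> 8" "n \<noteq> 9" using np by auto
    hence "n \<ge> 10" using assms(1) by linarith
    thus "connected_induced vertices adj"
      using no_prime_imp_connected primes np by blast
  qed
qed

end
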